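(* For every bounded affine permutation $f\in\mathcal B$, the function $\tilde F_f(x_1,\dots,x_k;y_1,\dots,y_n)$ is symmetric in $x_1,\dots,x_k$.
   Context: Let $1\le k\le n-1$. $\tilde S_n$ is the group of bijections $f:\mathbb Z\to\mathbb Z$ with $f(i+n)=f(i)+n$, and $$\mathcal B=\{f\in\tilde S_n:\ \tfrac1n\textstyle\sum_{i=1}^n(f(i)-i)=k,\ i\le f(i)\le i+n \text{ for all } i\}.$$ **The function $\tilde F_f$.** Consider the grid with $k$ horizontal lines (rows $i=1,\dots,k$ from top to bottom, oriented rightwards, row $i$ of weight $x_i$) and vertical lines indexed by $j\in\mathbb Z$ (oriented upwards, column $j$ of weight $y_j$ with $y_{j+n}=y_j$). A compatible coloring $\kappa$ assigns integers to all edges: $h_{i,j}$ to the horizontal edge immediately to the left of vertex $(i,j)$ (so $h_{i,j+1}$ is on the edge to its right), $v_{i,j}$ to the vertical edge immediately below vertex $(i,j)$, and $v_{0,j}$ to the top edge of column $j$ (so $v_{i-1,j}$ is on the edge immediately above $(i,j)$), such that: (i) $h_{i,j+n}=h_{i,j}+n$ and $v_{i,j+n}=v_{i,j}+n$; (ii) $v_{k,j}=j$ and $v_{0,j}=f^{-1}(j)$ for all $j$; (iii) at each vertex $(i,j)$, either (bump) $v_{i-1,j}=h_{i,j}\ne h_{i,j+1}=v_{i,j}$, or (cross) $v_{i-1,j}=v_{i,j}\ne h_{i,j}=h_{i,j+1}$. The weight of vertex $(i,j)$ is $\frac{1}{1+x_i-y_j}$ for a bump and $\frac{x_i-y_j}{1+x_i-y_j}$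 for a cross. Then $\tilde F_f(x_1,\dots,x_k;y_1,\dots,y_n)$ is the sum over all compatible colorings $\kappa$ of the product of the weights of the vertices $(i,j)$, $1\le i\le k$, $1\le j\le n$. *)

theory Defs
  imports Complex_Main "HOL-Library.FuncSet" "HOL-Combinatorics.Permutations"
begin

definition affine_perms :: "nat \<Rightarrow> (int \<Rightarrow> int) set" where
  "affine_perms n = {f. bij f \<and> (\<forall>i. f (i + int n) = f i + int n)}"

definition bounded_affine_perms :: "nat \<Rightarrow> nat \<Rightarrow> (int \<Rightarrow> int) set" where
  "bounded_affine_perms k n =
     {f \<in> affine_perms n.
        (1 / rat_of_nat n) * (\<Sum>i = 1..int n. rat_of_int (f i - i)) = rat_of_nat k \<and>
        (\<forall>i. i \<le> f i \<and> f i \<le> i + int n)}"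

text \<open>
  An edge labelling is a pair of functions \<open>h\<close>, \<open>v\<close>: for rows \<open>i = 1..k\<close> from top to bottom,
  \<open>h i j\<close> is the label of the horizontal edge immediately to the left of vertex \<open>(i, j)\<close>, and
  \<open>v i j\<close> is the label of the vertical edge immediately below it; \<open>v 0 j\<close> labels the top edge
  of column \<open>j\<close>.
\<close>

type_synonym labels = "nat \<Rightarrow> int \<Rightarrow> int"

definition is_bump :: "labels \<Rightarrow> labels \<Rightarrow> nat \<Rightarrow> int \<Rightarrow> bool" where
  "is_bump h v i j \<longleftrightarrow>
     v (i - 1) j = h i j \<and> h i j \<noteq> h i (j + 1) \<and> h i (j + 1) = v i j"

definition is_cross :: "labels \<Rightarrow> labels \<Rightarrow> nat \<Rightarrow> int \<Rightarrow> bool" where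
  "is_cross h v i j \<longleftrightarrow>
     v (i - 1) j = v i j \<and> v i j \<noteq> h i j \<and> h i j = h i (j + 1)"

text \<open>
  The functions are required to be \<open>undefined\<close> on row indices at which there are no edges, so that
  each coloring of the grid is represented by exactly one pair.
\<close>

definition compatible_colorings :: "nat \<Rightarrow> nat \<Rightarrow> (int \<Rightarrow> int) \<Rightarrow> (labels \<times> labels) set" where
  "compatible_colorings k n f =
     {(h, v). h \<in> extensional {1..k} \<and> v \<in> extensional {0..k} \<and>
        (\<forall>i\<in>{1..k}. \<forall>j. h i (j + int n) = h i j + int n) \<and>
        (\<forall>i\<in>{0..k}. \<forall>j. v i (j + int n) = v i j + int n) \<and>
        (\<forall>j. v k j = j) \<and> (\<forall>j. v 0 j = inv f j) \<and>
        (\<forall>i\<in>{1..k}. \<forall>j. is_bump h v i j \<or> is_cross h v i j)}"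

definition vertex_weight ::
    "(nat \<Rightarrow> 'a::field) \<Rightarrow> (int \<Rightarrow> 'a) \<Rightarrow> labels \<Rightarrow> labels \<Rightarrow> nat \<Rightarrow> int \<Rightarrow> 'a" where
  "vertex_weight x y h v i j =
     (if is_bump h v i j then 1 / (1 + x i - y j) else (x i - y j) / (1 + x i - y j))"

text \<open>
  Only \<open>x 1, \<dots>, x k\<close> and \<open>y 1, \<dots>, y n\<close> are used, so the periodic extension of the column
  weights need not be imposed. Division by zero yields \<open>0\<close>, so the value is the intended one only
  where all \<open>1 + x i - y j\<close> are nonzero.
\<close>

definition F_tilde ::
    "nat \<Rightarrow> nat \<Rightarrow> (int \<Rightarrow> int) \<Rightarrow> (nat \<Rightarrow> 'a::field) \<Rightarrow> (int \<Rightarrow> 'a) \<Rightarrow> 'a" where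
  "F_tilde k n f x y =
     (\<Sum>(h, v)\<in>compatible_colorings k n f. \<Prod>i = 1..k. \<Prod>j = 1..int n. vertex_weight x y h v i j)"

text \<open>
  The sum ranges over a finite set, so it does not degenerate to \<open>0\<close>: a row without bumps would have
  a constant horizontal label, so by periodicity a coloring is determined by its bumps in the
  columns \<open>1..n\<close>.
\<close>

lemma coloring_row_determined:
  assumes n: "n > 0"
    and per: "\<And>j. h i (j + int n) = h i j + int n"
    and vtx: "\<And>j. is_bump h v i j \<or> is_cross h v i j"
    and vtx': "\<And>j. is_bump h' v' i j \<or> is_cross h' v' i j"
    and bumps: "\<And>j. is_bump h v i j \<longleftrightarrow> is_bump h' v' i j"
    and v: "v i = v' i"
  shows "h i = h' i" "v (i - 1) = v' (i - 1)"
proof -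
  have eq: "h i j = h' i j" for j
  proof -
    have "\<exists>m<n. is_bump h v i (j - int n + int m)"
    proof (rule ccontr)
      assume "\<not> ?thesis"
      then have c: "is_cross h v i (j - int n + int m)" if "m < n" for m
        using that vtx by blast
      have "m \<le> n \<Longrightarrow> h i (j - int n + int m) = h i (j - int n)" for m
      proof (induction m)
        case (Suc m)
        have "j - int n + int (Suc m) = (j - int n + int m) + 1" by simp
        then show ?case
          using Suc c[of m] unfolding is_cross_def by (metis Suc_le_lessD less_imp_le)
      qed simp
      from this[of n] have "h i j = h i (j - int n)" by simp
      with per[of "j - int n"] n show False by simp
    qed
    then obtain m where m: "m < n" and b: "is_bump h v i (j - int n + int m)" by blast
    define a where "a = j - int n + int m + 1"
    have "h i (a + int d) = h' i (a + int d)" for d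
    proof (induction d)
      case 0
      show ?case
        using b bumps v unfolding is_bump_def a_def by (metis add.right_neutral of_nat_0)
    next
      case (Suc d)
      have s: "a + int (Suc d) = (a + int d) + 1" by simp
      show ?case
        using Suc vtx[of "a + int d"] vtx'[of "a + int d"] bumps[of "a + int d"] v
        unfolding is_bump_def is_cross_def s by metis
    qed
    from this[of "n - m - 1"] show ?thesis using m by (simp add: a_def of_nat_diff)
  qed
  then show "h i = h' i" by blast
  show "v (i - 1) = v' (i - 1)"
  proof
    fix j
    show "v (i - 1) j = v' (i - 1) j"
      using eq vtx[of j] vtx'[of j] bumps[of j] v unfolding is_bump_def is_cross_def by metis
  qed
qed

lemma finite_compatible_colorings:
  assumes n: "n > 0"
  shows "finite (compatible_colorings k n f)"
proof (rule inj_on_finite)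
  let ?B = "\<lambda>(h, v). {(i, j). i \<in> {1..k} \<and> j \<in> {0..<int n} \<and> is_bump h v i j}"
  show "?B ` compatible_colorings k n f \<subseteq> Pow ({1..k} \<times> {0..<int n})" by auto
  show "finite (Pow ({1..k} \<times> {0..<int n}))" by simp
  show "inj_on ?B (compatible_colorings k n f)"
  proof (rule inj_onI, clarify)
    fix h v h' v'
    assume A: "(h, v) \<in> compatible_colorings k n f" "(h', v') \<in> compatible_colorings k n f"
      and B: "{(i, j). i \<in> {1..k} \<and> j \<in> {0..<int n} \<and> is_bump h v i j}
            = {(i, j). i \<in> {1..k} \<and> j \<in> {0..<int n} \<and> is_bump h' v' i j}"
    have red: "is_bump h v i j \<longleftrightarrow> is_bump h v i (j mod int n)"
      if hv: "(h, v) \<in> compatible_colorings k n f" and i: "i \<in> {1..k}" for h v i j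
    proof -
      have s: "is_bump h v i (j + int n) \<longleftrightarrow> is_bump h v i j" for j
      proof -
        have e: "j + int n + 1 = (j + 1) + int n" by simp
        have "i - 1 \<in> {0..k}" "i \<in> {0..k}" using i by auto
        then have "h i (j + int n) = h i j + int n" "h i (j + int n + 1) = h i (j + 1) + int n"
          "v i (j + int n) = v i j + int n" "v (i - 1) (j + int n) = v (i - 1) j + int n"
          using hv i unfolding compatible_colorings_def e by blast+
        then show ?thesis unfolding is_bump_def by auto
      qed
      have up: "is_bump h v i (j + int m * int n) \<longleftrightarrow> is_bump h v i j" for j m
      proof (induction m)
        case (Suc m)
        then show ?case using s[of "j + int m * int n"] by (simp add: algebra_simps)
      qed simp
      show ?thesis
      proof (cases "j div int n \<ge> 0")
        case True
        have "j = j mod int n + int (nat (j div int n)) * int n" using True by simp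
        then show ?thesis using up by metis
      next
        case False
        have "j mod int n = j + int (nat (- (j div int n))) * int n"
          using False by (simp add: minus_div_mult_eq_mod [symmetric])
        then show ?thesis using up by metis
      qed
    qed
    have bumps: "is_bump h v i j \<longleftrightarrow> is_bump h' v' i j" if "i \<in> {1..k}" for i j
    proof -
      have "j mod int n \<in> {0..<int n}" using n by simp
      then have "is_bump h v i (j mod int n) \<longleftrightarrow> is_bump h' v' i (j mod int n)"
        using B that by blast
      then show ?thesis using red[OF A(1) that] red[OF A(2) that] by blast
    qed
    have row: "h i = h' i \<and> v (i - 1) = v' (i - 1)" if i: "i \<in> {1..k}" and "v i = v' i" for i
    proof -
      have 1: "\<And>j. h i (j + int n) = h i j + int n"
        and 2: "\<And>j. is_bump h v i j \<or> is_cross h v i j"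
        and 3: "\<And>j. is_bump h' v' i j \<or> is_cross h' v' i j"
        using A i unfolding compatible_colorings_def by blast+
      show ?thesis using coloring_row_determined[OF n 1 2 3 bumps[OF i] that(2)] by blast
    qed
    have vk: "v k = v' k" using A unfolding compatible_colorings_def by auto
    have veq: "d \<le> k \<Longrightarrow> v (k - d) = v' (k - d)" for d
    proof (induction d)
      case (Suc d)
      then show ?case using row[of "k - d"] by simp
    qed (use vk in simp)
    have v: "v i = v' i" if "i \<le> k" for i using veq[of "k - i"] that by simp
    have h: "h i = h' i" if "i \<in> {1..k}" for i using row[OF that] v that by simp
    have ext: "h \<in> extensional {1..k}" "h' \<in> extensional {1..k}"
      "v \<in> extensional {0..k}" "v' \<in> extensional {0..k}"
      using A unfolding compatible_colorings_def by blast+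
    show "h = h' \<and> v = v'"
      using extensionalityI[OF ext(1,2)] extensionalityI[OF ext(3,4)] h v by auto
  qed
qed

end

theory Submission
  imports Defs "HOL-Computational_Algebra.Polynomial"
begin

text \<open>
  It suffices to exchange \<open>x i\<close> and \<open>x (i + 1)\<close>, with the labels outside the rows \<open>i\<close> and \<open>i + 1\<close>
  held fixed. Split the two rows into columns and slide an R-matrix
  \<open>1 - (x i - x (i + 1)) P\<close>, where \<open>P\<close> swaps the two horizontal labels, across all columns of a
  period (Yang--Baxter). The two rows close up under a shift of the labels by \<open>n\<close>, which commutes
  with \<open>P\<close>, so taking the trace gives
  \<open>(1 - (x i - x (i + 1))\<^sup>2) (A - A') = 0\<close> for the two-row sums \<open>A\<close> and \<open>A'\<close> before and after the
  exchange. As a polynomial identity it can be cancelled. The exclusion of vertices with two equal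
  labels is harmless: a bijective labelling of the bottom edges never meets an equal label in a
  quasi-periodic row, and it induces a bijective labelling of the top edges.
\<close>

section \<open>Label propagation in a single row\<close>

definition quasi_periodic :: "nat \<Rightarrow> (int \<Rightarrow> int) \<Rightarrow> bool" where
  "quasi_periodic n g \<longleftrightarrow> (\<forall>j. g (j + int n) = g j + int n)"

text \<open>Condition (iii) for one row, with \<open>lo\<close> the labels below it and
  \<open>up\<close> those above. It is detached from the row index so that rows can be replaced
  individually.\<close>

definition row_coloring :: "(int \<Rightarrow> int) \<Rightarrow> (int \<Rightarrow> int) \<Rightarrow> (int \<Rightarrow> int) \<Rightarrow> bool" where
  "row_coloring h lo up \<longleftrightarrow>
     (\<forall>j. (up j = h j \<and> h j \<noteq> h (j + 1) \<and> h (j + 1) = lo j) \<or>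
          (up j = lo j \<and> lo j \<noteq> h j \<and> h j = h (j + 1)))"

lemma quasi_periodic_mult:
  assumes "quasi_periodic n g"
  shows "g (j + int n * d) = g j + int n * d"
proof -
  have up: "g (j + int n * int e) = g j + int n * int e" for j e
  proof (induction e)
    case (Suc e)
    have "g (j + int n * int (Suc e)) = g ((j + int n * int e) + int n)"
      by (simp add: algebra_simps)
    also have "\<dots> = g (j + int n * int e) + int n"
      using assms by (auto simp: quasi_periodic_def)
    finally show ?case using Suc by (simp add: algebra_simps)
  qed simp
  show ?thesis
  proof (cases "d \<ge> 0")
    case True
    then show ?thesis using up[of j "nat d"] by simp
  next
    case False
    then show ?thesis using up[of "j + int n * d" "nat (- d)"] by (simp add: algebra_simps)
  qed
qed

text \<open>Going left from column \<open>j\<close>, the horizontal label can change only at a bump.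
  Without one it would be constant, contradicting \<open>h (j - n) = h j - n\<close>. Equal labels
  are still allowed to meet in \<open>row\<close>.\<close>

lemma horizontal_label_source:
  assumes "n > 0" "quasi_periodic n h"
    and row: "\<And>j. (up j = h j \<and> h (j + 1) = lo j) \<or> (up j = lo j \<and> h j = h (j + 1))"
  shows "\<exists>i<j. h j = lo i \<and> h (i + 1) = lo i \<and> up i = h i"
proof (rule ccontr)
  assume no: "\<not> ?thesis"
  have const: "h (j - int d) = h j" for d
  proof (induction d)
    case (Suc d)
    have "(j - int (Suc d)) + 1 = j - int d" by simp
    then show ?case using row[of "j - int (Suc d)"] no Suc by fastforce
  qed simp
  have "h (j - int n + int n) = h (j - int n) + int n"
    using assms(2) unfolding quasi_periodic_def by blast
  then show False using const[of n] assms(1) by simp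
qed

text \<open>The label \<open>h j\<close> comes from the bottom of a column strictly left of
  \<open>j\<close>, so injectivity of \<open>lo\<close> separates it from \<open>lo j\<close>. This
  supplies the inequalities of condition (iii).\<close>

lemma horizontal_neq_vertical:
  assumes "n > 0" "quasi_periodic n h" "inj lo"
    and row: "\<And>j. (up j = h j \<and> h (j + 1) = lo j) \<or> (up j = lo j \<and> h j = h (j + 1))"
  shows "h j \<noteq> lo j"
  using horizontal_label_source[OF assms(1,2) row, of j] assms(3)
  by (metis injD less_irrefl)

lemma row_coloringI:
  assumes "n > 0" "quasi_periodic n h" "inj lo"
    and row: "\<And>j. (up j = h j \<and> h (j + 1) = lo j) \<or> (up j = lo j \<and> h j = h (j + 1))"
  shows "row_coloring h lo up"
  using horizontal_neq_vertical[OF assms] row unfolding row_coloring_def by metis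

text \<open>Labels move up and to the right: a cross at \<open>j\<close> outputs
  \<open>lo j\<close>, a bump at \<open>j\<close> outputs some \<open>lo i\<close> with
  \<open>i < j\<close>. Two equal outputs would trace back to one bottom label leaving the row
  twice.\<close>

lemma row_coloring_inj:
  assumes "n > 0" "quasi_periodic n h" "inj lo" and row: "row_coloring h lo up"
  shows "inj up"
proof -
  have weak: "(up j = h j \<and> h (j + 1) = lo j) \<or> (up j = lo j \<and> h j = h (j + 1))" for j
    using row unfolding row_coloring_def by blast
  have strong: "(up j = h j \<and> h j \<noteq> h (j + 1) \<and> h (j + 1) = lo j) \<or>
      (up j = lo j \<and> lo j \<noteq> h j \<and> h j = h (j + 1))" for j
    using row unfolding row_coloring_def by blast
  \<comment> \<open>To the right of a bump at \<open>j\<close>, the row carries only bottom labels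
    of columns \<ge> \<open>j\<close>: the bump has ejected everything that came from further
    left.\<close>
  have fwd: "\<exists>i\<ge>j. i < j + 1 + int d \<and> h (j + 1 + int d) = lo i" if "h j \<noteq> h (j + 1)" for j d
  proof (induction d)
    case 0
    show ?case using strong[of j] that by (intro exI[of _ j]) auto
  next
    case (Suc d)
    have e: "j + 1 + int (Suc d) = (j + 1 + int d) + 1" by simp
    show ?case using strong[of "j + 1 + int d"]
    proof
      assume "up (j + 1 + int d) = h (j + 1 + int d) \<and> h (j + 1 + int d) \<noteq> h (j + 1 + int d + 1)
        \<and> h (j + 1 + int d + 1) = lo (j + 1 + int d)"
      then show ?thesis unfolding e by (intro exI[of _ "j + 1 + int d"]) auto
    next
      assume "up (j + 1 + int d) = lo (j + 1 + int d) \<and> lo (j + 1 + int d) \<noteq> h (j + 1 + int d) \<and>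
        h (j + 1 + int d) = h (j + 1 + int d + 1)"
      then show ?thesis using Suc unfolding e by force
    qed
  qed
  have ne: False if eq: "up j = up j'" and lt: "j < j'" for j j'
  proof (cases "h j \<noteq> h (j + 1)")
    case True
    then have "up j = h j" using strong[of j] by blast
    obtain i where i: "i < j" "h j = lo i"
      using horizontal_label_source[where up = up and lo = lo, OF assms(1,2) weak] by metis
    have "\<exists>i\<ge>j. up j' = lo i"
    proof (cases "h j' \<noteq> h (j' + 1)")
      case True
      then have "up j' = h j'" using strong[of j'] by blast
      moreover have "j' = j + 1 + int (nat (j' - j - 1))" using lt by simp
      ultimately show ?thesis using fwd[OF \<open>h j \<noteq> h (j + 1)\<close>] by metis
    next
      case False
      then have "up j' = lo j'" using strong[of j'] by blast
      then show ?thesis using lt by (intro exI[of _ j']) auto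
    qed
    then show False using i eq \<open>up j = h j\<close> assms(3) by (metis injD not_less)
  next
    case False
    then have lj: "up j = lo j" using strong[of j] by blast
    show False
    proof (cases "h j' \<noteq> h (j' + 1)")
      case True
      then have "up j' = h j'" using strong[of j'] by blast
      \<comment> \<open>Column \<open>i\<close> is where the label entered the row by turning right.
        Injectivity gives \<open>i = j\<close>, but column \<open>j\<close> is a cross.\<close>
      moreover obtain i where i: "h j' = lo i" "h (i + 1) = lo i" "up i = h i"
        using horizontal_label_source[where up = up and lo = lo, OF assms(1,2) weak] by metis
      ultimately have "i = j" using lj eq assms(3) by (metis injD)
      then show False using i False strong[of j] by metis
    next
      case False
      then have "up j' = lo j'" using strong[of j'] by blast
      then show False using lj eq lt assms(3) by (metis injD less_irrefl)
    qed
  qed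
  show ?thesis
  proof (rule injI)
    fix j j' assume "up j = up j'"
    then show "j = j'" using ne[of j j'] ne[of j' j] by (cases j j' rule: linorder_cases) auto
  qed
qed

section \<open>Column operators and the Yang--Baxter relation\<close>

text \<open>
  The state \<open>(p, q)\<close> holds the labels of the upper and lower horizontal edge entering a column with
  bottom label \<open>b\<close>, and \<open>c\<close> says in which of the two rows there is a bump. Equal labels are
  allowed to meet here; bump and cross then both contribute.
\<close>

definition step :: "int \<Rightarrow> bool \<times> bool \<Rightarrow> int \<times> int \<Rightarrow> int \<times> int" where
  "step b c s = (if fst c then (if snd c then snd s else b) else fst s, if snd c then b else snd s)"

definition out :: "int \<Rightarrow> bool \<times> bool \<Rightarrow> int \<times> int \<Rightarrow> int" where
  "out b c s = (if fst c then fst s else if snd c then snd s else b)"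

text \<open>Only numerators appear, since the denominator is the same for bump and cross. The
  arguments stand for \<open>x1 - y j\<close> (upper row) and \<open>x2 - y j\<close> (lower
  row).\<close>

definition column_weight :: "'a::comm_ring_1 \<Rightarrow> 'a \<Rightarrow> bool \<times> bool \<Rightarrow> 'a" where
  "column_weight \<alpha> \<beta> c = (if fst c then 1 else \<alpha>) * (if snd c then 1 else \<beta>)"

text \<open>Turns a function of the state leaving the column into a function of the state entering
  it, with the top label forced to be \<open>t\<close>.\<close>

definition column_op ::
    "int \<Rightarrow> int \<Rightarrow> 'a::comm_ring_1 \<Rightarrow> 'a \<Rightarrow> (int \<times> int \<Rightarrow> 'a) \<Rightarrow> int \<times> int \<Rightarrow> 'a" where
  "column_op b t \<alpha> \<beta> \<phi> s =
     (\<Sum>c\<in>UNIV. if out b c s = t then column_weight \<alpha> \<beta> c * \<phi> (step b c s) else 0)"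

text \<open>Since \<open>\<phi>\<close> depends on the state after all columns, the last column acts
  on it first.\<close>

primrec transfer ::
    "(nat \<Rightarrow> int) \<Rightarrow> (nat \<Rightarrow> int) \<Rightarrow> (nat \<Rightarrow> 'a::comm_ring_1) \<Rightarrow> 'a \<Rightarrow> 'a \<Rightarrow> nat \<Rightarrow>
     (int \<times> int \<Rightarrow> 'a) \<Rightarrow> int \<times> int \<Rightarrow> 'a" where
  "transfer b t y x1 x2 0 \<phi> = \<phi>"
| "transfer b t y x1 x2 (Suc m) \<phi> =
     transfer b t y x1 x2 m (column_op (b m) (t m) (x1 - y m) (x2 - y m) \<phi>)"

lemma column_op_expand:
  "column_op b t \<alpha> \<beta> \<phi> (p, q) =
     (if t = p then \<phi> (q, b) + \<beta> * \<phi> (b, q) else 0) +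
     (if t = q then \<alpha> * \<phi> (p, b) else 0) + (if t = b then \<alpha> * \<beta> * \<phi> (p, q) else 0)"
proof -
  have U: "(UNIV :: (bool \<times> bool) set) = {(True, True), (True, False), (False, True), (False, False)}"
    by auto
  show ?thesis unfolding column_op_def U
    by (auto simp: out_def step_def column_weight_def algebra_simps)
qed

text \<open>Yang--Baxter for one column: the R-matrix acts on the entering state on the left and on
  the leaving state on the right. The coefficients of the three indicators \<open>t = p\<close>,
  \<open>t = q\<close>, \<open>t = b\<close> agree separately, so coinciding labels do no
  harm.\<close>

lemma column_op_exchange:
  "column_op b t \<alpha> \<beta> \<phi> (p, q) - (\<alpha> - \<beta>) * column_op b t \<alpha> \<beta> \<phi> (q, p) =
   column_op b t \<beta> \<alpha> \<phi> (p, q) - (\<alpha> - \<beta>) * column_op b t \<beta> \<alpha> (\<phi> \<circ> prod.swap) (p, q)"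
  by (simp add: column_op_expand algebra_simps)

lemma transfer_diff:
  "transfer b t y x1 x2 m (\<lambda>s. \<phi> s - u * \<psi> s) s =
   transfer b t y x1 x2 m \<phi> s - u * transfer b t y x1 x2 m \<psi> s"
proof (induction m arbitrary: \<phi> \<psi>)
  case (Suc m)
  have "column_op (b m) (t m) \<alpha> \<beta> (\<lambda>s. \<phi> s - u * \<psi> s) =
      (\<lambda>s. column_op (b m) (t m) \<alpha> \<beta> \<phi> s - u * column_op (b m) (t m) \<alpha> \<beta> \<psi> s)" for \<alpha> \<beta>
    by (rule ext) (auto simp: column_op_def sum_distrib_left algebra_simps
        simp flip: sum_subtractf intro!: sum.cong)
  then show ?case using Suc by simp
qed simp

text \<open>The relations for single columns chain together because the difference of the two column
  parameters is \<open>x1 - x2\<close> in every column.\<close>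

lemma transfer_exchange:
  "transfer b t y x1 x2 m \<phi> (p, q) - (x1 - x2) * transfer b t y x1 x2 m \<phi> (q, p) =
   transfer b t y x2 x1 m \<phi> (p, q) - (x1 - x2) * transfer b t y x2 x1 m (\<phi> \<circ> prod.swap) (p, q)"
proof (induction m arbitrary: \<phi> p q)
  case (Suc m)
  let ?L = "column_op (b m) (t m) (x1 - y m) (x2 - y m)"
  let ?L' = "column_op (b m) (t m) (x2 - y m) (x1 - y m)"
  have eq: "(\<lambda>s. ?L \<phi> s - (x1 - x2) * (?L \<phi> \<circ> prod.swap) s) =
      (\<lambda>s. ?L' \<phi> s - (x1 - x2) * ?L' (\<phi> \<circ> prod.swap) s)"
  proof
    fix s :: "int \<times> int"
    show "?L \<phi> s - (x1 - x2) * (?L \<phi> \<circ> prod.swap) s =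
      ?L' \<phi> s - (x1 - x2) * ?L' (\<phi> \<circ> prod.swap) s"
      using column_op_exchange[of "b m" "t m" "x1 - y m" "x2 - y m" \<phi> "fst s" "snd s"]
      by (cases s) simp
  qed
  \<comment> \<open>The induction hypothesis at \<open>?L \<phi>\<close> moves the R-matrix past the
    first \<open>m\<close> columns; \<open>eq\<close> then moves it past the last one.\<close>
  have "transfer b t y x1 x2 (Suc m) \<phi> (p, q) - (x1 - x2) * transfer b t y x1 x2 (Suc m) \<phi> (q, p) =
      transfer b t y x2 x1 m (\<lambda>s. ?L \<phi> s - (x1 - x2) * (?L \<phi> \<circ> prod.swap) s) (p, q)"
    by (simp only: transfer.simps Suc transfer_diff)
  also have "\<dots> = transfer b t y x2 x1 m (\<lambda>s. ?L' \<phi> s - (x1 - x2) * ?L' (\<phi> \<circ> prod.swap) s) (p, q)"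
    by (simp only: eq)
  finally show ?case by (simp only: transfer.simps transfer_diff)
qed simp

section \<open>The trace over one period\<close>

text \<open>Indicator that the final state is the initial one shifted by \<open>n\<close>. Summing
  over initial states makes this a twisted trace.\<close>

definition closing :: "nat \<Rightarrow> int \<times> int \<Rightarrow> int \<times> int \<Rightarrow> 'a::comm_ring_1" where
  "closing n s s' = (if s' = (fst s + int n, snd s + int n) then 1 else 0)"

lemma closing_swap: "closing n (p, q) \<circ> prod.swap = closing n (q, p)"
  by (auto simp: closing_def fun_eq_iff)

text \<open>With \<open>B\<close> the trace with one swap \<open>P\<close> inserted, applying the
  exchange to \<open>(p, q)\<close> and to \<open>(q, p)\<close> gives two linear relations between
  \<open>A\<close> and \<open>B\<close>; eliminating \<open>B\<close> leaves the square of
  \<open>x1 - x2\<close>.\<close>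

lemma transfer_trace:
  fixes x1 x2 :: "'a::comm_ring_1" and y :: "nat \<Rightarrow> 'a" and S :: "int set"
    and b t :: "nat \<Rightarrow> int" and m n :: nat
  defines "A \<equiv> \<lambda>x1 x2. \<Sum>(p, q)\<in>S \<times> S. transfer b t y x1 x2 m (closing n (p, q)) (p, q)"
  shows "(1 - (x1 - x2)\<^sup>2) * (A x1 x2 - A x2 x1) = 0"
proof -
  define u where "u = x1 - x2"
  define B where "B = (\<lambda>x1 x2. \<Sum>(p, q)\<in>S \<times> S. transfer b t y x1 x2 m (closing n (p, q)) (q, p))"
  have swap: "(\<Sum>(p, q)\<in>S \<times> S. g p q) = (\<Sum>(p, q)\<in>S \<times> S. g q p)" for g :: "int \<Rightarrow> int \<Rightarrow> 'a"
    by (rule sum.reindex_bij_witness[of _ prod.swap prod.swap]) auto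
  have ex: "transfer b t y x1 x2 m \<phi> (p, q) - u * transfer b t y x1 x2 m \<phi> (q, p) =
     transfer b t y x2 x1 m \<phi> (p, q) - u * transfer b t y x2 x1 m (\<phi> \<circ> prod.swap) (p, q)" for \<phi> p q
    unfolding u_def by (rule transfer_exchange)
  have "A x1 x2 - u * B x1 x2 =
     (\<Sum>(p, q)\<in>S \<times> S. transfer b t y x1 x2 m (closing n (p, q)) (p, q)
         - u * transfer b t y x1 x2 m (closing n (p, q)) (q, p))"
    by (simp add: A_def B_def sum_distrib_left split_def flip: sum_subtractf)
  also have "\<dots> = A x2 x1 - u * (\<Sum>(p, q)\<in>S \<times> S. transfer b t y x2 x1 m (closing n (q, p)) (p, q))"
    unfolding ex closing_swap
    by (simp add: A_def B_def sum_distrib_left split_def flip: sum_subtractf)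
  also have "(\<Sum>(p, q)\<in>S \<times> S. transfer b t y x2 x1 m (closing n (q, p)) (p, q)) = B x2 x1"
    unfolding B_def by (rule swap)
  finally have 1: "A x1 x2 - u * B x1 x2 = A x2 x1 - u * B x2 x1" .
  have "B x1 x2 - u * A x1 x2 =
     (\<Sum>(p, q)\<in>S \<times> S. transfer b t y x1 x2 m (closing n (p, q)) (q, p)
         - u * transfer b t y x1 x2 m (closing n (p, q)) (p, q))"
    by (simp add: A_def B_def sum_distrib_left split_def flip: sum_subtractf)
  also have "\<dots> = B x2 x1 - u * (\<Sum>(p, q)\<in>S \<times> S. transfer b t y x2 x1 m (closing n (q, p)) (q, p))"
    unfolding ex closing_swap
    by (simp add: A_def B_def sum_distrib_left split_def flip: sum_subtractf)
  also have "(\<Sum>(p, q)\<in>S \<times> S. transfer b t y x2 x1 m (closing n (q, p)) (q, p)) = A x2 x1"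
    unfolding A_def by (rule swap)
  finally have 2: "B x1 x2 - u * A x1 x2 = B x2 x1 - u * A x2 x1" .
  have "A x1 x2 - A x2 x1 = u * (B x1 x2 - B x2 x1)"
    using 1 by (simp add: algebra_simps)
  also have "B x1 x2 - B x2 x1 = u * (A x1 x2 - A x2 x1)"
    using 2 by (simp add: algebra_simps)
  finally show ?thesis by (simp add: u_def[symmetric] algebra_simps power2_eq_square)
qed

section \<open>The transfer operator as a sum over bump patterns\<close>

primrec trajectory ::
    "(nat \<Rightarrow> int) \<Rightarrow> (nat \<Rightarrow> bool \<times> bool) \<Rightarrow> int \<times> int \<Rightarrow> nat \<Rightarrow> int \<times> int" where
  "trajectory b c s 0 = s"
| "trajectory b c s (Suc i) = step (b i) (c i) (trajectory b c s i)"

lemma trajectory_cong: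
  "(\<And>i. i < m \<Longrightarrow> c i = c' i) \<Longrightarrow> trajectory b c s m = trajectory b c' s m"
  by (induction m) auto

lemma transfer_eq_sum:
  "transfer b t y x1 x2 m \<phi> s =
     (\<Sum>c\<in>{..<m} \<rightarrow>\<^sub>E UNIV.
        if \<forall>i<m. out (b i) (c i) (trajectory b c s i) = t i
        then (\<Prod>i<m. column_weight (x1 - y i) (x2 - y i) (c i)) * \<phi> (trajectory b c s m) else 0)"
proof (induction m arbitrary: \<phi>)
  case (Suc m)
  let ?w = "\<lambda>i. column_weight (x1 - y i) (x2 - y i)"
  let ?g = "\<lambda>m \<phi> c. if \<forall>i<m. out (b i) (c i) (trajectory b c s i) = t i
        then (\<Prod>i<m. ?w i (c i)) * \<phi> (trajectory b c s m) else 0"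
  have PiE: "({..<Suc m} \<rightarrow>\<^sub>E (UNIV :: (bool \<times> bool) set)) =
      (\<lambda>(d, c). c(m := d)) ` (UNIV \<times> ({..<m} \<rightarrow>\<^sub>E UNIV))"
    unfolding lessThan_Suc by (rule PiE_insert_eq)
  have inj: "inj_on (\<lambda>(d, c). c(m := d)) (UNIV \<times> ({..<m} \<rightarrow>\<^sub>E (UNIV :: (bool \<times> bool) set)))"
    by (rule inj_combinator) simp
  have upd: "?g (Suc m) \<phi> (c(m := d)) =
      (if \<forall>i<m. out (b i) (c i) (trajectory b c s i) = t i
       then (\<Prod>i<m. ?w i (c i)) *
         (if out (b m) d (trajectory b c s m) = t m
          then ?w m d * \<phi> (step (b m) d (trajectory b c s m)) else 0) else 0)" for c d
  proof -
    \<comment> \<open>The state entering column \<open>i\<close> depends only on the pattern in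
      earlier columns, so changing the pattern at \<open>m\<close> does not affect it.\<close>
    have tr: "i \<le> m \<Longrightarrow> trajectory b (c(m := d)) s i = trajectory b c s i" for i
      by (rule trajectory_cong) auto
    have 1: "(\<forall>i<Suc m. out (b i) ((c(m := d)) i) (trajectory b (c(m := d)) s i) = t i) \<longleftrightarrow>
        (\<forall>i<m. out (b i) (c i) (trajectory b c s i) = t i) \<and> out (b m) d (trajectory b c s m) = t m"
      unfolding All_less_Suc using tr by (simp cong: conj_cong) blast
    have 2: "(\<Prod>i<Suc m. ?w i ((c(m := d)) i)) = (\<Prod>i<m. ?w i (c i)) * ?w m d"
      by (simp cong: prod.cong_simp)
    show ?thesis unfolding 1 2 trajectory.simps tr[OF order_refl] by (auto simp: mult.assoc)
  qed
  have "(\<Sum>c\<in>{..<Suc m} \<rightarrow>\<^sub>E UNIV. ?g (Suc m) \<phi> c) =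
      (\<Sum>(d, c)\<in>UNIV \<times> ({..<m} \<rightarrow>\<^sub>E UNIV). ?g (Suc m) \<phi> (c(m := d)))"
    unfolding PiE sum.reindex[OF inj] by (simp only: o_def split_def)
  also have "\<dots> = (\<Sum>c\<in>{..<m} \<rightarrow>\<^sub>E UNIV. \<Sum>d\<in>UNIV. ?g (Suc m) \<phi> (c(m := d)))"
    unfolding sum.cartesian_product[symmetric] by (rule sum.swap)
  also have "\<dots> = (\<Sum>c\<in>{..<m} \<rightarrow>\<^sub>E UNIV. ?g m (column_op (b m) (t m) (x1 - y m) (x2 - y m) \<phi>) c)"
  proof (rule sum.cong[OF refl])
    have aux: "(\<Sum>d\<in>D. if P then p * q d else 0) = (if P then p * sum q D else 0)"
      for D :: "(bool \<times> bool) set" and P and p :: 'a and q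
      by (simp add: sum_distrib_left)
    fix c
    show "(\<Sum>d\<in>UNIV. ?g (Suc m) \<phi> (c(m := d))) = ?g m (column_op (b m) (t m) (x1 - y m) (x2 - y m) \<phi>) c"
      unfolding upd column_op_def
      by (rule aux)
  qed
  finally show ?case unfolding transfer.simps Suc by (rule sym)
qed simp

section \<open>Extending data from one period to all columns\<close>

text \<open>Column \<open>i + 1\<close> receives \<open>F i\<close>: columns \<open>1..n\<close>
  correspond to indices \<open>0..<n\<close>.\<close>

definition quasi_periodic_extension :: "nat \<Rightarrow> (nat \<Rightarrow> int) \<Rightarrow> int \<Rightarrow> int" where
  "quasi_periodic_extension n F j = F (nat ((j - 1) mod int n)) + int n * ((j - 1) div int n)"

lemma quasi_periodic_extension_eq:
  assumes "i < n"
  shows "quasi_periodic_extension n F (int i + 1 + int n * d) = F i + int n * d"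
proof -
  have "int i + 1 + int n * d - 1 = int i + int n * d" by simp
  moreover have "(int i + int n * d) mod int n = int i" using assms by simp
  moreover have "(int i + int n * d) div int n = d" using assms by simp
  ultimately show ?thesis by (simp add: quasi_periodic_extension_def)
qed

text \<open>For \<open>i = n - 1\<close> the right neighbour lies in the next period; the hypothesis
  on \<open>F n\<close> is what glues the periods together.\<close>

lemma quasi_periodic_extension_Suc:
  assumes "i < n" "F n = F 0 + int n"
  shows "quasi_periodic_extension n F (int i + 1 + int n * d + 1) = F (Suc i) + int n * d"
proof (cases "Suc i < n")
  case True
  have "int i + 1 + int n * d + 1 = int (Suc i) + 1 + int n * d" by simp
  then show ?thesis using quasi_periodic_extension_eq[OF True] by metis
next
  case False
  then have n: "Suc i = n" using assms(1) by simp
  then have e: "int i + 1 + int n * d + 1 = int 0 + 1 + int n * (d + 1)"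
    by (auto simp: algebra_simps)
  have "quasi_periodic_extension n F (int 0 + 1 + int n * (d + 1)) = F 0 + int n * (d + 1)"
    using assms(1) by (intro quasi_periodic_extension_eq) simp
  then show ?thesis unfolding e n using assms(2) by (simp add: algebra_simps)
qed

lemma quasi_periodic_quasi_periodic_extension:
  "n > 0 \<Longrightarrow> quasi_periodic n (quasi_periodic_extension n F)"
proof -
  assume n: "n > 0"
  have "j + int n - 1 = (j - 1) + int n" for j by simp
  moreover have "((j - 1) + int n) div int n = (j - 1) div int n + 1" for j using n by simp
  moreover have "((j - 1) + int n) mod int n = (j - 1) mod int n" for j by simp
  ultimately show ?thesis
    unfolding quasi_periodic_def quasi_periodic_extension_def
    by (simp add: algebra_simps)
qed

lemma column_decompose:
  assumes "n > 0"
  obtains i d where "i < n" "j = int i + 1 + int n * d"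
proof
  show "nat ((j - 1) mod int n) < n"
    using assms by (simp add: nat_less_iff)
  show "j = int (nat ((j - 1) mod int n)) + 1 + int n * ((j - 1) div int n)"
    using assms mod_mult_div_eq[of "j - 1" "int n"] by simp
qed

lemma quasi_periodic_eqI:
  assumes "n > 0" "quasi_periodic n g" "quasi_periodic n g'"
    and "\<And>i. i < n \<Longrightarrow> g (int i + 1) = g' (int i + 1)"
  shows "g = g'"
proof
  fix j
  obtain i d where "i < n" "j = int i + 1 + int n * d" using column_decompose[OF assms(1)] .
  then show "g j = g' j" using assms(2-4) by (simp add: quasi_periodic_mult)
qed

section \<open>Two-row colorings and closed trajectories\<close>

definition two_rows :: "nat \<Rightarrow> (int \<Rightarrow> int) \<Rightarrow> (int \<Rightarrow> int) \<Rightarrow>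
    ((int \<Rightarrow> int) \<times> (int \<Rightarrow> int) \<times> (int \<Rightarrow> int)) set" where
  "two_rows n b t = {(h1, h2, m). quasi_periodic n h1 \<and> quasi_periodic n h2 \<and> quasi_periodic n m \<and>
     row_coloring h1 m t \<and> row_coloring h2 b m}"

text \<open>In a row coloring a bump is exactly a change of the horizontal label, so the weight can
  be read off from \<open>h\<close> alone.\<close>

definition row_weight :: "nat \<Rightarrow> 'a::comm_ring_1 \<Rightarrow> (int \<Rightarrow> 'a) \<Rightarrow> (int \<Rightarrow> int) \<Rightarrow> 'a" where
  "row_weight n x y h = (\<Prod>j = 1..int n. if h j \<noteq> h (j + 1) then 1 else x - y j)"

lemma row_weight_eq:
  "row_weight n x y h =
     (\<Prod>i<n. if h (int i + 1) \<noteq> h (int i + 1 + 1) then 1 else x - y (int i + 1))"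
  unfolding row_weight_def
  by (rule prod.reindex_bij_witness[of _ "\<lambda>i. int i + 1" "\<lambda>j. nat (j - 1)"]) auto

definition bump_pattern :: "nat \<Rightarrow> (int \<Rightarrow> int) \<Rightarrow> (int \<Rightarrow> int) \<Rightarrow> nat \<Rightarrow> bool \<times> bool" where
  "bump_pattern n h1 h2 = (\<lambda>i\<in>{..<n}. (h1 (int i + 1) \<noteq> h1 (int i + 1 + 1), h2 (int i + 1) \<noteq> h2 (int i + 1 + 1)))"

text \<open>The pairs of initial state and bump pattern that survive in the trace. Equal labels are
  not excluded here.\<close>

definition closed_trajectories ::
    "nat \<Rightarrow> (int \<Rightarrow> int) \<Rightarrow> (int \<Rightarrow> int) \<Rightarrow> ((int \<times> int) \<times> (nat \<Rightarrow> bool \<times> bool)) set" where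
  "closed_trajectories n b t = {((p, q), c). c \<in> {..<n} \<rightarrow>\<^sub>E UNIV \<and>
     (\<forall>i<n. out (b (int i + 1)) (c i) (trajectory (\<lambda>i. b (int i + 1)) c (p, q) i) = t (int i + 1)) \<and>
     trajectory (\<lambda>i. b (int i + 1)) c (p, q) n = (p + int n, q + int n)}"

lemma two_rows_trajectory:
  assumes "(h1, h2, m) \<in> two_rows n b t" "i \<le> n"
  shows "trajectory (\<lambda>i. b (int i + 1)) (bump_pattern n h1 h2) (h1 1, h2 1) i =
    (h1 (int i + 1), h2 (int i + 1))"
  using assms(2)
proof (induction i)
  case (Suc i)
  have "row_coloring h1 m t" "row_coloring h2 b m"
    using assms(1) by (auto simp: two_rows_def)
  then have r: "(t j = h1 j \<and> h1 j \<noteq> h1 (j + 1) \<and> h1 (j + 1) = m j) \<or>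
      (t j = m j \<and> m j \<noteq> h1 j \<and> h1 j = h1 (j + 1))"
    "(m j = h2 j \<and> h2 j \<noteq> h2 (j + 1) \<and> h2 (j + 1) = b j) \<or>
      (m j = b j \<and> b j \<noteq> h2 j \<and> h2 j = h2 (j + 1))" for j
    unfolding row_coloring_def by blast+
  have s: "int (Suc i) + 1 = (int i + 1) + 1" by simp
  show ?case unfolding s
    using Suc r[of "int i + 1"] by (auto simp: bump_pattern_def step_def)
qed simp

lemma two_rows_closed_trajectory:
  assumes "(h1, h2, m) \<in> two_rows n b t"
  shows "((h1 1, h2 1), bump_pattern n h1 h2) \<in> closed_trajectories n b t"
proof -
  have "row_coloring h1 m t" "row_coloring h2 b m" "quasi_periodic n h1" "quasi_periodic n h2"
    using assms by (auto simp: two_rows_def)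
  then have r: "(t j = h1 j \<and> h1 j \<noteq> h1 (j + 1) \<and> h1 (j + 1) = m j) \<or>
      (t j = m j \<and> m j \<noteq> h1 j \<and> h1 j = h1 (j + 1))"
    "(m j = h2 j \<and> h2 j \<noteq> h2 (j + 1) \<and> h2 (j + 1) = b j) \<or>
      (m j = b j \<and> b j \<noteq> h2 j \<and> h2 j = h2 (j + 1))"
    and q: "h1 (int n + 1) = h1 1 + int n" "h2 (int n + 1) = h2 1 + int n" for j
    unfolding row_coloring_def quasi_periodic_def by (blast, blast, metis add.commute, metis add.commute)
  have "out (b (int i + 1)) (bump_pattern n h1 h2 i) (h1 (int i + 1), h2 (int i + 1)) = t (int i + 1)"
    if "i < n" for i
    using r[of "int i + 1"] that by (auto simp: out_def bump_pattern_def)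
  then show ?thesis
    using two_rows_trajectory[OF assms] q
    unfolding closed_trajectories_def by (auto simp: bump_pattern_def)
qed

text \<open>The trajectory recovers \<open>h1\<close> and \<open>h2\<close> on one period, hence
  everywhere; \<open>h2\<close> and \<open>b\<close> then determine the middle labels.\<close>

lemma two_rows_inj:
  assumes "n > 0"
  shows "inj_on (\<lambda>(h1, h2, m). ((h1 1, h2 1), bump_pattern n h1 h2)) (two_rows n b t)"
proof (rule inj_onI)
  fix z z'
  assume zz: "z \<in> two_rows n b t" "z' \<in> two_rows n b t"
    "(\<lambda>(h1, h2, m). ((h1 1, h2 1 :: int), bump_pattern n h1 h2)) z =
     (\<lambda>(h1, h2, m). ((h1 1, h2 1), bump_pattern n h1 h2)) z'"
  obtain h1 h2 m h1' h2' m' where z: "z = (h1, h2, m)" "z' = (h1', h2', m')"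
    by (metis prod_cases3)
  have A: "(h1, h2, m) \<in> two_rows n b t" "(h1', h2', m') \<in> two_rows n b t"
    and eq: "h1 1 = h1' 1" "h2 1 = h2' 1" "bump_pattern n h1 h2 = bump_pattern n h1' h2'"
    using zz by (auto simp: z)
  have "h1 (int i + 1) = h1' (int i + 1) \<and> h2 (int i + 1) = h2' (int i + 1)" if "i < n" for i
    using two_rows_trajectory[OF A(1), of i] two_rows_trajectory[OF A(2), of i] that eq by simp
  moreover have "quasi_periodic n h1" "quasi_periodic n h1'" "quasi_periodic n h2" "quasi_periodic n h2'"
    using A by (auto simp: two_rows_def)
  ultimately have h: "h1 = h1'" "h2 = h2'"
    using quasi_periodic_eqI[OF assms] by blast+
  have "m j = (if h2 j \<noteq> h2 (j + 1) then h2 j else b j)"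
    "m' j = (if h2' j \<noteq> h2' (j + 1) then h2' j else b j)" for j
    using A by (auto simp: two_rows_def row_coloring_def)
  then have "m = m'" using h by auto
  then show "z = z'" using h z by blast
qed

text \<open>Unrolling a closed trajectory gives rows satisfying (iii) up to the inequalities. These
  follow from injectivity, first in the lower row from \<open>b\<close>, then in the upper row
  because the middle labels are injective in turn.\<close>

lemma two_rows_surj:
  assumes n: "n > 0" and b: "quasi_periodic n b" "inj b" and t: "quasi_periodic n t"
    and c: "(s, c) \<in> closed_trajectories n b t"
  shows "(s, c) \<in> (\<lambda>(h1, h2, m). ((h1 1, h2 1), bump_pattern n h1 h2)) ` two_rows n b t"
proof -
  define T where "T = trajectory (\<lambda>i. b (int i + 1)) c s"
  \<comment> \<open>The label on the edge between the two rows, i.e. the output of the lower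
    vertex.\<close>
  define M where "M i = (if snd (c i) then snd (T i) else b (int i + 1))" for i
  define h1 where "h1 = quasi_periodic_extension n (fst \<circ> T)"
  define h2 where "h2 = quasi_periodic_extension n (snd \<circ> T)"
  define m where "m = quasi_periodic_extension n M"
  have T0: "T 0 = s" and TSuc: "T (Suc i) = step (b (int i + 1)) (c i) (T i)" for i
    by (simp_all add: T_def)
  have cE: "c \<in> {..<n} \<rightarrow>\<^sub>E UNIV"
    and out: "i < n \<Longrightarrow> out (b (int i + 1)) (c i) (T i) = t (int i + 1)"
    and Tn: "fst (T n) = fst s + int n" "snd (T n) = snd s + int n" for i
    using c by (auto simp: closed_trajectories_def T_def)
  have qp: "quasi_periodic n h1" "quasi_periodic n h2" "quasi_periodic n m"
    unfolding h1_def h2_def m_def by (simp_all add: quasi_periodic_quasi_periodic_extension n)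
  have h_eq: "h1 (int i + 1 + int n * d) = fst (T i) + int n * d"
    "h2 (int i + 1 + int n * d) = snd (T i) + int n * d"
    "m (int i + 1 + int n * d) = M i + int n * d"
    "h1 (int i + 1 + int n * d + 1) = fst (T (Suc i)) + int n * d"
    "h2 (int i + 1 + int n * d + 1) = snd (T (Suc i)) + int n * d" if "i < n" for i d
    using quasi_periodic_extension_eq[OF that] Tn T0 unfolding h1_def h2_def m_def
      quasi_periodic_extension_Suc[where F = "fst \<circ> T", simplified o_apply T0, OF that Tn(1)]
      quasi_periodic_extension_Suc[where F = "snd \<circ> T", simplified o_apply T0, OF that Tn(2)]
    by simp_all
  have weak2: "(m j = h2 j \<and> h2 (j + 1) = b j) \<or> (m j = b j \<and> h2 j = h2 (j + 1))" for j
  proof -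
    obtain i d where id: "i < n" "j = int i + 1 + int n * d" using column_decompose[OF n] .
    show ?thesis unfolding id(2)
      using h_eq[OF id(1), of d] quasi_periodic_mult[OF b(1), of "int i + 1" d]
      by (simp add: TSuc step_def M_def)
  qed
  have weak1: "(t j = h1 j \<and> h1 (j + 1) = m j) \<or> (t j = m j \<and> h1 j = h1 (j + 1))" for j
  proof -
    obtain i d where id: "i < n" "j = int i + 1 + int n * d" using column_decompose[OF n] .
    show ?thesis unfolding id(2)
      using h_eq[OF id(1), of d] quasi_periodic_mult[OF t, of "int i + 1" d] out[OF id(1)]
      by (auto simp: TSuc step_def M_def out_def)
  qed
  have row2: "row_coloring h2 b m"
    using row_coloringI[where up = m, OF n qp(2) b(2) weak2] .
  then have "inj m" using row_coloring_inj[OF n qp(2) b(2)] by blast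
  then have row1: "row_coloring h1 m t"
    using row_coloringI[where up = t, OF n qp(1) _ weak1] by blast
  \<comment> \<open>\<open>bump_pattern\<close> sees only changes of label, so a bump of
    \<open>c\<close> must not replace a label by an equal one.\<close>
  have "bump_pattern n h1 h2 i = c i" for i
  proof (cases "i < n")
    case True
    have "h2 (int i + 1) \<noteq> b (int i + 1)"
      using horizontal_neq_vertical[where up = m, OF n qp(2) b(2) weak2] .
    moreover have "h1 (int i + 1) \<noteq> m (int i + 1)"
      using horizontal_neq_vertical[where up = t, OF n qp(1) \<open>inj m\<close> weak1] .
    ultimately show ?thesis
      using True h_eq[OF True, of 0]
      by (auto simp: bump_pattern_def TSuc step_def M_def prod_eq_iff)
  next
    case False
    then show ?thesis using cE by (auto simp: bump_pattern_def PiE_def extensional_def)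
  qed
  then have "bump_pattern n h1 h2 = c" by blast
  moreover have "(h1 1, h2 1) = s" using h_eq[OF n, of 0] T0 by simp
  moreover have "(h1, h2, m) \<in> two_rows n b t" using qp row1 row2 by (simp add: two_rows_def)
  ultimately show ?thesis by (intro image_eqI[of _ _ "(h1, h2, m)"]) auto
qed

text \<open>Two-row colorings biject with closed trajectories, and weights match. The finite set
  \<open>S\<close> contains every label entering column 1, so restricting the trace to
  \<open>S \<times> S\<close> loses no term.\<close>

lemma two_rows_weight_eq_transfer_trace:
  fixes x1 x2 :: "'a::comm_ring_1" and S :: "int set"
  assumes n: "n > 0" and b: "quasi_periodic n b" "inj b" and t: "quasi_periodic n t"
    and S: "finite S" "\<And>h1 h2 m. (h1, h2, m) \<in> two_rows n b t \<Longrightarrow> h1 1 \<in> S \<and> h2 1 \<in> S"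
  shows "(\<Sum>(h1, h2, m)\<in>two_rows n b t. row_weight n x1 y h1 * row_weight n x2 y h2) =
    (\<Sum>(p, q)\<in>S \<times> S. transfer (\<lambda>i. b (int i + 1)) (\<lambda>i. t (int i + 1)) (\<lambda>i. y (int i + 1)) x1 x2 n
       (closing n (p, q)) (p, q))"
proof -
  let ?w = "\<lambda>c. \<Prod>i<n. column_weight (x1 - y (int i + 1)) (x2 - y (int i + 1)) (c i)"
  let ?C = "{..<n} \<rightarrow>\<^sub>E (UNIV :: (bool \<times> bool) set)"
  let ?f = "\<lambda>(h1, h2, m). ((h1 1, h2 1), bump_pattern n h1 h2)"
  have img: "?f ` two_rows n b t = closed_trajectories n b t"
  proof (rule equalityI; rule subsetI)
    fix z assume "z \<in> ?f ` two_rows n b t"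
    then obtain h1 h2 m where "(h1, h2, m) \<in> two_rows n b t" "z = ((h1 1, h2 1), bump_pattern n h1 h2)"
      by auto
    then show "z \<in> closed_trajectories n b t" using two_rows_closed_trajectory by simp
  next
    fix z assume "z \<in> closed_trajectories n b t"
    then show "z \<in> ?f ` two_rows n b t" using two_rows_surj[OF n b t] by (cases z) simp
  qed
  have sub: "closed_trajectories n b t \<subseteq> (S \<times> S) \<times> ?C"
  proof
    fix z assume "z \<in> closed_trajectories n b t"
    then obtain h1 h2 m where "(h1, h2, m) \<in> two_rows n b t" "z = ((h1 1, h2 1), bump_pattern n h1 h2)"
      unfolding img[symmetric] by auto
    then show "z \<in> (S \<times> S) \<times> ?C" using S(2) by (simp add: bump_pattern_def)
  qed
  have fin: "finite ((S \<times> S) \<times> ?C)" using S(1) by (simp add: finite_PiE)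
  have "(\<Sum>(p, q)\<in>S \<times> S. transfer (\<lambda>i. b (int i + 1)) (\<lambda>i. t (int i + 1)) (\<lambda>i. y (int i + 1)) x1 x2 n
       (closing n (p, q)) (p, q)) =
     (\<Sum>s\<in>S \<times> S. \<Sum>c\<in>?C. if (s, c) \<in> closed_trajectories n b t then ?w c else 0)"
    unfolding transfer_eq_sum
  proof (rule sum.cong[OF refl], clarify)
    fix p q
    show "(\<Sum>c\<in>?C. if \<forall>i<n. out (b (int i + 1)) (c i) (trajectory (\<lambda>i. b (int i + 1)) c (p, q) i) = t (int i + 1)
        then ?w c * closing n (p, q) (trajectory (\<lambda>i. b (int i + 1)) c (p, q) n) else 0) =
      (\<Sum>c\<in>?C. if ((p, q), c) \<in> closed_trajectories n b t then ?w c else 0)"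
    proof (rule sum.cong[OF refl])
      fix c assume c: "c \<in> ?C"
      have mem: "((p, q), c) \<in> closed_trajectories n b t \<longleftrightarrow>
          (\<forall>i<n. out (b (int i + 1)) (c i) (trajectory (\<lambda>i. b (int i + 1)) c (p, q) i) = t (int i + 1)) \<and>
          trajectory (\<lambda>i. b (int i + 1)) c (p, q) n = (fst (p, q) + int n, snd (p, q) + int n)"
        unfolding closed_trajectories_def using c by simp
      have aux: "(if P then w * (if Q then 1 else 0) else 0) = (if P \<and> Q then w else 0)"
        for P Q and w :: 'a by simp
      show "(if \<forall>i<n. out (b (int i + 1)) (c i) (trajectory (\<lambda>i. b (int i + 1)) c (p, q) i) = t (int i + 1)
          then ?w c * closing n (p, q) (trajectory (\<lambda>i. b (int i + 1)) c (p, q) n) else 0) =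
        (if ((p, q), c) \<in> closed_trajectories n b t then ?w c else 0)"
        unfolding mem closing_def by (rule aux)
    qed
  qed
  also have "\<dots> = (\<Sum>(s, c)\<in>(S \<times> S) \<times> ?C. if (s, c) \<in> closed_trajectories n b t then ?w c else 0)"
    by (rule sum.cartesian_product)
  also have "\<dots> = (\<Sum>(s, c)\<in>closed_trajectories n b t. ?w c)"
    by (rule sum.mono_neutral_cong_right[OF fin sub]; simp only: split_def prod.collapse; simp)
  also have "\<dots> = (\<Sum>(h1, h2, m)\<in>two_rows n b t. ?w (bump_pattern n h1 h2))"
    unfolding img[symmetric] sum.reindex[OF two_rows_inj[OF n]] by (simp add: o_def split_def)
  also have "\<dots> = (\<Sum>(h1, h2, m)\<in>two_rows n b t. row_weight n x1 y h1 * row_weight n x2 y h2)"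
  proof (rule sum.cong[OF refl], clarify)
    fix h1 h2 m
    show "?w (bump_pattern n h1 h2) = row_weight n x1 y h1 * row_weight n x2 y h2"
      unfolding row_weight_eq prod.distrib[symmetric]
      by (rule prod.cong[OF refl]) (simp add: column_weight_def bump_pattern_def)
  qed
  finally show ?thesis ..
qed

section \<open>Exchanging the parameters of two rows\<close>

lemma two_rows_exchange_aux:
  fixes x1 x2 :: "'a::comm_ring_1" and y :: "int \<Rightarrow> 'a"
  assumes n: "n > 0" and b: "quasi_periodic n b" "inj b" and t: "quasi_periodic n t"
  defines "A \<equiv> \<lambda>x1 x2. \<Sum>(h1, h2, m)\<in>two_rows n b t. row_weight n x1 y h1 * row_weight n x2 y h2"
  shows "(1 - (x1 - x2)\<^sup>2) * (A x1 x2 - A x2 x1) = 0"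
proof (cases "finite (two_rows n b t)")
  case True
  define S where "S = (\<lambda>(h1, h2, m). h1 1) ` two_rows n b t \<union> (\<lambda>(h1, h2, m). h2 1) ` two_rows n b t"
  have S: "finite S" using True by (simp add: S_def)
  have S': "h1 1 \<in> S \<and> h2 1 \<in> S" if "(h1, h2, m) \<in> two_rows n b t" for h1 h2 m
    unfolding S_def using imageI[OF that, of "\<lambda>(h1, h2, m). h1 1"] imageI[OF that, of "\<lambda>(h1, h2, m). h2 1"]
    by simp
  have eq: "A z z' = (\<Sum>(p, q)\<in>S \<times> S. transfer (\<lambda>i. b (int i + 1)) (\<lambda>i. t (int i + 1))
      (\<lambda>i. y (int i + 1)) z z' n (closing n (p, q)) (p, q))" for z z'
    unfolding A_def using S' by (intro two_rows_weight_eq_transfer_trace n b t S) blast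
  show ?thesis unfolding eq by (rule transfer_trace)
\<comment> \<open>A sum over an infinite set is 0 by convention.\<close>
qed (simp add: A_def)

text \<open>
  The relation above can be cancelled only where \<open>(x1 - x2)\<^sup>2 \<noteq> 1\<close>, so \<open>x1\<close> is replaced by an
  indeterminate first.
\<close>

lemma two_rows_exchange:
  fixes x1 x2 :: "'a::idom"
  assumes n: "n > 0" and b: "quasi_periodic n b" "inj b" and t: "quasi_periodic n t"
  shows "(\<Sum>(h1, h2, m)\<in>two_rows n b t. row_weight n x1 y h1 * row_weight n x2 y h2) =
    (\<Sum>(h1, h2, m)\<in>two_rows n b t. row_weight n x2 y h1 * row_weight n x1 y h2)"
proof -
  define A where "A = (\<lambda>x1 x2. \<Sum>(h1, h2, m)\<in>two_rows n b t.
    row_weight n x1 (\<lambda>j. [:y j:]) h1 * row_weight n x2 (\<lambda>j. [:y j:]) h2)"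
  \<comment> \<open>A polynomial of degree 2 with leading coefficient \<open>-1\<close>.\<close>
  have "1 - ([:0, 1:] - [:x2:])\<^sup>2 \<noteq> 0"
    by (simp add: power2_eq_square one_pCons)
  then have eq: "A [:0, 1:] [:x2:] = A [:x2:] [:0, 1:]"
    using two_rows_exchange_aux[OF n b t, of "[:0, 1:]" "[:x2:]" "\<lambda>j. [:y j:]"]
    unfolding A_def by simp
  \<comment> \<open>Evaluation at \<open>x1\<close> is a ring homomorphism that fixes constants and
    sends the indeterminate to \<open>x1\<close>.\<close>
  have row: "poly (row_weight n z (\<lambda>j. [:y j:]) h) x1 = row_weight n (poly z x1) y h" for z h
    unfolding row_weight_def poly_prod by (rule prod.cong) auto
  have "poly (A z z') x1 =
    (\<Sum>(h1, h2, m)\<in>two_rows n b t. row_weight n (poly z x1) y h1 * row_weight n (poly z' x1) y h2)" for z z'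
    unfolding A_def by (simp add: poly_sum split_def row)
  from this[of "[:0, 1:]" "[:x2:]"] this[of "[:x2:]" "[:0, 1:]"] eq show ?thesis by simp
qed

section \<open>From two rows to the whole grid\<close>

lemma compatible_colorings_iff:
  "(h, v) \<in> compatible_colorings k n f \<longleftrightarrow>
     h \<in> extensional {1..k} \<and> v \<in> extensional {0..k} \<and>
     (\<forall>i\<in>{1..k}. quasi_periodic n (h i)) \<and> (\<forall>i\<in>{0..k}. quasi_periodic n (v i)) \<and>
     v k = (\<lambda>j. j) \<and> v 0 = inv f \<and> (\<forall>i\<in>{1..k}. row_coloring (h i) (v i) (v (i - 1)))"
  unfolding compatible_colorings_def quasi_periodic_def row_coloring_def is_bump_def is_cross_def
  by (auto simp: fun_eq_iff)

text \<open>Induction from the bottom, where the labelling is the identity, up through the rows by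
  \<open>row_coloring_inj\<close>.\<close>

lemma compatible_coloring_inj:
  assumes n: "n > 0" and C: "(h, v) \<in> compatible_colorings k n f" and i: "i \<le> k"
  shows "inj (v i)"
  using i
proof (induction i rule: inc_induct)
  case base
  then show ?case using C by (simp add: compatible_colorings_iff)
next
  case (step i)
  then have "Suc i \<in> {1..k}" by simp
  then have "quasi_periodic n (h (Suc i))" "row_coloring (h (Suc i)) (v (Suc i)) (v i)"
    using C unfolding compatible_colorings_iff by fastforce+
  then show ?case using row_coloring_inj[OF n] step.IH by blast
qed

definition coloring_sum :: "nat \<Rightarrow> nat \<Rightarrow> (int \<Rightarrow> int) \<Rightarrow> (nat \<Rightarrow> 'a::comm_ring_1) \<Rightarrow> (int \<Rightarrow> 'a) \<Rightarrow> 'a" where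
  "coloring_sum k n f x y =
     (\<Sum>(h, v)\<in>compatible_colorings k n f. \<Prod>i = 1..k. row_weight n (x i) y (h i))"

text \<open>The denominators do not depend on the coloring and factor out, leaving a sum that is
  polynomial in the weights.\<close>

lemma F_tilde_eq_coloring_sum:
  "F_tilde k n f x y =
     (\<Prod>i = 1..k. \<Prod>j = 1..int n. inverse (1 + x i - y j)) * coloring_sum k n f x y"
proof -
  have "vertex_weight x y h v i j =
      inverse (1 + x i - y j) * (if h i j \<noteq> h i (j + 1) then 1 else x i - y j)"
    if "(h, v) \<in> compatible_colorings k n f" "i \<in> {1..k}" for h v i j
  proof -
    have "is_bump h v i j \<or> is_cross h v i j"
      using that unfolding compatible_colorings_def by blast
    then have "is_bump h v i j \<longleftrightarrow> h i j \<noteq> h i (j + 1)"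
      unfolding is_bump_def is_cross_def by blast
    then show ?thesis by (simp add: vertex_weight_def divide_inverse mult.commute)
  qed
  then have "(\<Prod>i = 1..k. \<Prod>j = 1..int n. vertex_weight x y h v i j) =
      (\<Prod>i = 1..k. \<Prod>j = 1..int n. inverse (1 + x i - y j)) * (\<Prod>i = 1..k. row_weight n (x i) y (h i))"
    if "(h, v) \<in> compatible_colorings k n f" for h v
    using that unfolding row_weight_def by (simp flip: prod.distrib)
  then show ?thesis
    unfolding F_tilde_def coloring_sum_def sum_distrib_left
    by (auto intro!: sum.cong)
qed

text \<open>\<open>r\<close> erases rows \<open>i\<close> and \<open>Suc i\<close> together with the
  edges between them. What remains constrains the erased part only through the labels just below and
  just above the two rows.\<close>

lemma coloring_fiber:
  assumes C: "(h, v) \<in> compatible_colorings k n f" and i: "1 \<le> i" "Suc i \<le> k"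
  defines "r \<equiv> \<lambda>(h, v). (h(i := undefined, Suc i := undefined), v(i := undefined))"
  defines "\<psi> \<equiv> \<lambda>(h1, h2, m). (h(i := h1, Suc i := h2), v(i := m))"
  shows "{c \<in> compatible_colorings k n f. r c = r (h, v)} = \<psi> ` two_rows n (v (Suc i)) (v (i - 1))"
proof (intro equalityI subsetI)
  fix c assume "c \<in> {c \<in> compatible_colorings k n f. r c = r (h, v)}"
  then obtain h' v' where c: "c = (h', v')" and C': "(h', v') \<in> compatible_colorings k n f"
    and eq: "h'(i := undefined, Suc i := undefined) = h(i := undefined, Suc i := undefined)"
      "v'(i := undefined) = v(i := undefined)"
    by (cases c) (simp add: r_def)
  have v: "v' a = v a" if "a \<noteq> i" for a using fun_cong[OF eq(2), of a] that by simp
  have h: "h' a = h a" if "a \<noteq> i" "a \<noteq> Suc i" for a using fun_cong[OF eq(1), of a] that by simp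
  have "quasi_periodic n (h' i)" "quasi_periodic n (h' (Suc i))" "quasi_periodic n (v' i)"
    "row_coloring (h' i) (v' i) (v' (i - 1))"
    using iffD1[OF compatible_colorings_iff C'] i by simp_all
  moreover have "\<forall>a\<in>{1..k}. row_coloring (h' a) (v' a) (v' (a - 1))"
    using iffD1[OF compatible_colorings_iff C'] by blast
  then have "row_coloring (h' (Suc i)) (v' (Suc i)) (v' i)"
    using i by (metis atLeastAtMost_iff diff_Suc_1 le_SucI)
  moreover have "v' (i - 1) = v (i - 1)" "v' (Suc i) = v (Suc i)" using v i by auto
  ultimately have "(h' i, h' (Suc i), v' i) \<in> two_rows n (v (Suc i)) (v (i - 1))"
    unfolding two_rows_def by simp
  moreover have "c = \<psi> (h' i, h' (Suc i), v' i)"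
  proof -
    have "h' = h(i := h' i, Suc i := h' (Suc i))" "v' = v(i := v' i)"
      by (rule ext, simp add: h v)+
    then show ?thesis unfolding c \<psi>_def by simp
  qed
  ultimately show "c \<in> \<psi> ` two_rows n (v (Suc i)) (v (i - 1))" by blast
next
  fix c assume "c \<in> \<psi> ` two_rows n (v (Suc i)) (v (i - 1))"
  then obtain h1 h2 m where c: "c = (h(i := h1, Suc i := h2), v(i := m))"
    and T: "(h1, h2, m) \<in> two_rows n (v (Suc i)) (v (i - 1))"
    unfolding \<psi>_def by (elim imageE) (simp split: prod.splits)
  have row: "row_coloring ((h(i := h1, Suc i := h2)) a) ((v(i := m)) a) ((v(i := m)) (a - 1))"
    if a: "a \<in> {1..k}" for a
  proof -
    consider "a = i" | "a = Suc i" | "a \<noteq> i" "a \<noteq> Suc i" by blast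
    then show ?thesis
    proof cases
      case 1
      \<comment> \<open>Subtraction on \<open>nat\<close> truncates, so this relies on
        \<open>1 \<le> i\<close>.\<close>
      have "i - 1 \<noteq> i" using i by simp
      then show ?thesis using 1 T by (simp add: two_rows_def)
    next
      case 3
      then have "a - 1 \<noteq> i" using a by auto
      then show ?thesis using iffD1[OF compatible_colorings_iff C] 3 a by simp
    qed (use T in \<open>simp add: two_rows_def\<close>)
  qed
  have "h(i := h1, Suc i := h2) \<in> extensional {1..k}" "v(i := m) \<in> extensional {0..k}"
    using iffD1[OF compatible_colorings_iff C] i by (simp_all add: extensional_def)
  moreover have "quasi_periodic n ((h(i := h1, Suc i := h2)) a)" if "a \<in> {1..k}" for a
    using iffD1[OF compatible_colorings_iff C] T that by (simp add: two_rows_def)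
  moreover have "quasi_periodic n ((v(i := m)) a)" if "a \<in> {0..k}" for a
    using iffD1[OF compatible_colorings_iff C] T that by (simp add: two_rows_def)
  moreover have "(v(i := m)) k = (\<lambda>j. j)" "(v(i := m)) 0 = inv f"
    using iffD1[OF compatible_colorings_iff C] i by simp_all
  ultimately have "c \<in> compatible_colorings k n f"
    unfolding c compatible_colorings_iff using row by blast
  then show "c \<in> {c \<in> compatible_colorings k n f. r c = r (h, v)}"
    by (simp add: c r_def fun_upd_twist)
qed

section \<open>Symmetry under all permutations\<close>

text \<open>Group the colorings by what lies outside rows \<open>i\<close> and \<open>Suc i\<close>.
  Each fiber contributes a common factor \<open>R\<close> times a two-row sum, to which
  \<open>two_rows_exchange\<close> applies.\<close>

lemma coloring_sum_adjacent:
  fixes x :: "nat \<Rightarrow> 'a::idom"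
  assumes n: "n > 0" and i: "1 \<le> i" "Suc i \<le> k"
  shows "coloring_sum k n f (x \<circ> Transposition.transpose i (Suc i)) y = coloring_sum k n f x y"
proof -
  let ?x = "x \<circ> Transposition.transpose i (Suc i)"
  let ?C = "compatible_colorings k n f"
  define r :: "labels \<times> labels \<Rightarrow> labels \<times> labels"
    where "r = (\<lambda>(h, v). (h(i := undefined, Suc i := undefined), v(i := undefined)))"
  define g where "g = (\<lambda>(x :: nat \<Rightarrow> 'a) (h, v :: labels). \<Prod>i = 1..k. row_weight n (x i) y (h i))"
  have fiber: "sum (g ?x) {c \<in> ?C. r c = w} = sum (g x) {c \<in> ?C. r c = w}" if "w \<in> r ` ?C" for w
  proof -
    from that obtain h v where C: "(h, v) \<in> ?C" and w: "w = r (h, v)" by fast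
    define \<psi> where "\<psi> = (\<lambda>(h1, h2, m). (h(i := h1, Suc i := h2), v(i := m)))"
    let ?T = "two_rows n (v (Suc i)) (v (i - 1))"
    define R where "R = (\<Prod>a\<in>{1..k} - {i} - {Suc i}. row_weight n (x a) y (h a))"
    have eq: "{c \<in> ?C. r c = w} = \<psi> ` ?T"
      unfolding w r_def \<psi>_def by (rule coloring_fiber[OF C i])
    have inj: "inj_on \<psi> ?T"
      by (rule inj_on_inverseI[where g = "\<lambda>w. (fst w i, fst w (Suc i), snd w i)"]) (auto simp: \<psi>_def)
    have split: "(\<Prod>a = 1..k. p a) = p i * (p (Suc i) * prod p ({1..k} - {i} - {Suc i}))"
      for p :: "nat \<Rightarrow> 'a"
    proof -
      have "(\<Prod>a = 1..k. p a) = p i * prod p ({1..k} - {i})"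
        using i by (intro prod.remove) auto
      also have "prod p ({1..k} - {i}) = p (Suc i) * prod p ({1..k} - {i} - {Suc i})"
        using i by (intro prod.remove) auto
      finally show ?thesis .
    qed
    \<comment> \<open>Stated for any \<open>z\<close> agreeing with \<open>x\<close> off the two
      rows, so that it covers both \<open>?x\<close> and \<open>x\<close>.\<close>
    have sum: "sum (g z) {c \<in> ?C. r c = w} =
        R * (\<Sum>(h1, h2, m)\<in>?T. row_weight n (z i) y h1 * row_weight n (z (Suc i)) y h2)"
      if z: "\<And>a. a \<noteq> i \<Longrightarrow> a \<noteq> Suc i \<Longrightarrow> z a = x a" for z
    proof -
      have "g z (\<psi> (h1, h2, m)) =
          R * (row_weight n (z i) y h1 * row_weight n (z (Suc i)) y h2)" for h1 h2 m
      proof -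
        have "(\<Prod>a\<in>{1..k} - {i} - {Suc i}. row_weight n (z a) y ((h(i := h1, Suc i := h2)) a)) = R"
          unfolding R_def using z by (intro prod.cong) auto
        then show ?thesis unfolding g_def \<psi>_def prod.case split by (simp add: algebra_simps)
      qed
      then show ?thesis
        unfolding eq sum.reindex[OF inj] sum_distrib_left
        by (intro sum.cong[OF refl]) (simp add: o_apply split: prod.split)
    qed
    have "inj (v (Suc i))" "quasi_periodic n (v (Suc i))" "quasi_periodic n (v (i - 1))"
      using compatible_coloring_inj[OF n C i(2)] C i by (auto simp: compatible_colorings_iff)
    then have "(\<Sum>(h1, h2, m)\<in>?T. row_weight n (x (Suc i)) y h1 * row_weight n (x i) y h2) =
        (\<Sum>(h1, h2, m)\<in>?T. row_weight n (x i) y h1 * row_weight n (x (Suc i)) y h2)"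
      using two_rows_exchange[OF n] by blast
    then show ?thesis by (simp add: sum transpose_eq_iff)
  qed
  have "coloring_sum k n f z y = (\<Sum>w\<in>r ` ?C. sum (g z) {c \<in> ?C. r c = w})" for z
    unfolding coloring_sum_def g_def by (rule sum.image_gen[OF finite_compatible_colorings[OF n]])
  then show ?thesis using fiber by simp
qed

lemma coloring_sum_permutes:
  fixes x :: "nat \<Rightarrow> 'a::idom"
  assumes n: "n > 0" and "\<sigma> permutes {1..k}"
  shows "coloring_sum k n f (x \<circ> \<sigma>) y = coloring_sum k n f x y"
proof -
  have adj: "coloring_sum k n f (x \<circ> apply_adj_transps is) y = coloring_sum k n f x y"
    if "\<And>i. i \<in> set is \<Longrightarrow> 1 \<le> i \<and> Suc i \<le> k" for "is" and x :: "nat \<Rightarrow> 'a"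
    using that
  proof (induction "is" arbitrary: x)
    case (Cons i "is")
    have "x \<circ> apply_adj_transps (i # is) =
        (x \<circ> Transposition.transpose i (Suc i)) \<circ> apply_adj_transps is"
      by (simp add: comp_assoc)
    moreover have "coloring_sum k n f (x \<circ> Transposition.transpose i (Suc i)) y = coloring_sum k n f x y"
      using Cons.prems by (intro coloring_sum_adjacent n) simp_all
    moreover have "coloring_sum k n f ((x \<circ> Transposition.transpose i (Suc i)) \<circ> apply_adj_transps is) y =
        coloring_sum k n f (x \<circ> Transposition.transpose i (Suc i)) y"
      using Cons.prems by (intro Cons.IH) simp_all
    ultimately show ?case by (simp only:)
  qed simp
  have transp: "coloring_sum k n f (x \<circ> Transposition.transpose a b) y = coloring_sum k n f x y"
    if "a \<in> {1..k}" "b \<in> {1..k}" "a < b" for a b and x :: "nat \<Rightarrow> 'a"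
    \<comment> \<open>The transposition of \<open>a\<close> and \<open>b\<close> is a product of
      adjacent ones with indices from \<open>a\<close> to \<open>b - 1\<close>, hence within
      \<open>{1..k}\<close>.\<close>
    using that adj[of "adj_transp_seq a b" x] set_adj_transp_seq[of a b]
    by (auto simp: adj_transp_seq_correct)
  show ?thesis
    using assms(2) finite_atLeastAtMost
  proof (induction arbitrary: x rule: permutes_induct)
    case (swap a b p)
    have "coloring_sum k n f (x \<circ> Transposition.transpose a b) y = coloring_sum k n f x y"
      using transp swap.hyps by (metis linorder_neqE_nat transpose_commute)
    then show ?case using swap.IH[of "x \<circ> Transposition.transpose a b"] by (simp only: comp_assoc)
  qed simp
qed

theorem theorem7p6:
  fixes n k :: nat
    and f :: "int \<Rightarrow> int"
    and x :: "nat \<Rightarrow> 'a::field_char_0"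
    and y :: "int \<Rightarrow> 'a"
    and \<sigma> :: "nat \<Rightarrow> nat"
  assumes "1 \<le> k" and "k \<le> n - 1"
    and "f \<in> bounded_affine_perms k n"
    and "\<And>i j. i \<in> {1..k} \<Longrightarrow> j \<in> {1..int n} \<Longrightarrow> 1 + x i - y j \<noteq> 0"
    and "\<sigma> permutes {1..k}"
  shows "F_tilde k n f (\<lambda>i. x (\<sigma> i)) y = F_tilde k n f x y"
proof -
  have "n > 0" using assms(1,2) by simp
  then have "coloring_sum k n f (\<lambda>i. x (\<sigma> i)) y = coloring_sum k n f x y"
    using coloring_sum_permutes[OF _ assms(5), of n f x y] by (simp add: o_def)
  \<comment> \<open>The prefactor is a product over all rows, so permuting the \<open>x i\<close>
    only reorders it.\<close>
  moreover have "(\<Prod>i = 1..k. \<Prod>j = 1..int n. inverse (1 + x (\<sigma> i) - y j)) =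
      (\<Prod>i = 1..k. \<Prod>j = 1..int n. inverse (1 + x i - y j))"
    using prod.permute[OF assms(5), of "\<lambda>i. \<Prod>j = 1..int n. inverse (1 + x i - y j)"]
    by (simp add: o_def)
  ultimately show ?thesis by (simp add: F_tilde_eq_coloring_sum)
qed

end
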